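(* Let $\Gamma\subset T\mathbb{S}^n$ be an isotropic immersed submanifold and let $\mathcal{U}\subset\mathbb{R}^{n+1}$ be an orthogonal submanifold of $\Gamma$ containing no focal points of $\Gamma$. Then for every $p\in\mathcal{U}$ there exists an open neighbourhood $V_p$ of $p$ in $\mathcal{U}$ such that $V_p\subset\Sigma_p$, where $$\Sigma_p:=\Psi\Big(\big\{((\xi,\eta),F(\xi,\eta)):(\xi,\eta)\in W\big\}\Big),$$ with $W\subseteq\Gamma$ open in $\Gamma$ and $F:W\to\mathbb{R}$ a smooth function such that $\theta|_W=\mathrm{d}F$.
   Context: "Smooth" means $C^2$. $\langle\cdot,\cdot\rangle$ is the Euclidean inner product. A subset $\mathcal N$ of a manifold $\mathcal M$ is immersed if $\mathcal N$ itself is a smooth manifold and the inclusion is a smooth immersion. Identify $T\mathbb{S}^n=\{(\xi,\eta)\in\mathbb{R}^{n+1}\times\mathbb{R}^{n+1}: |\xi|=1,\ \langle\xi,\eta\rangle=0\}$; $(\xi,\eta)$ corresponds to the oriented line $\{\eta+t\xi:t\in\mathbb{R}\}$. $\Psi:T\mathbb{S}^n\times\mathbb{R}\to\mathbb{R}^{n+1}$ is $\Psi((\xi,\eta),r)=\eta+r\xi$. Let $g$ be the round metric on $\mathbb{S}^n$ and $\pi:T\mathbb{S}^n\to\mathbb{S}^n$ the projection; the Liouville form is $\theta_{(\xi,\eta)}(X)=g_\xi(\mathrm{d}\pi(X),\eta)$ and $\Omega=-\mathrm{d}\theta$. $\Gamma$ is isotropic if $\Omega|_\Gamma=0$. A focal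 point of $\Gamma$ is a point $p\in\Psi(\Gamma\times\mathbb{R})$ such that $\Psi|_{\Gamma\times\mathbb{R}}$ fails to be an immersion at some point of $\Psi^{-1}(p)$. For a unit section $\nu$ of $T\mathbb{R}^{n+1}$ over $\Sigma$, $\Phi_\nu(q)=(\nu(q),q-\langle\nu(q),q\rangle\nu(q))\in T\mathbb{S}^n$. An immersed submanifold $\Sigma\subset\mathbb{R}^{n+1}$ is an orthogonal submanifold of $\Gamma$ if $\dim\Sigma>0$ and there exists a smooth unit normal section $\nu\in\Gamma(N\Sigma)$ with $\Phi_\nu(\Sigma)\subseteq\Gamma$.
   Formalization: In the definition of orthogonal submanifold, Φ_ν is additionally required to be continuous into Γ with its manifold topology (automatic for embedded Γ); with only Φ_ν(U) ⊆ Γ the claim fails for some immersed, non-embedded Γ. *)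

theory Defs
  imports "HOL-Analysis.Analysis"
begin

section \<open>Manifolds of class C2 with a point set inside a vector space\<close>

text \<open>
  A manifold carries its own topology, which may be finer than the one its points inherit from
  the surrounding type, and an atlas of charts \<open>(X, \<phi>)\<close>. The charts take values in a linear
  subspace \<open>model M\<close> of a Euclidean space, so that the dimension \<open>dim (model M)\<close> may be any
  natural number, including 0.
\<close>

record ('a, 'm) manifold =
  mtop :: "'a topology"
  model :: "'m set"
  atlas :: "('a set \<times> ('a \<Rightarrow> 'm)) set"

definition points :: "('a, 'm) manifold \<Rightarrow> 'a set" where
  "points M = topspace (mtop M)"

text \<open>
  Class C2 on a relatively open subset \<open>X\<close> of a linear subspace \<open>S\<close>. The derivatives at a point
  of \<open>X\<close> are determined on \<open>S\<close> only; their values off \<open>S\<close> are irrelevant, as one may compose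
  with the projection to \<open>S\<close>.
\<close>

definition C2_on :: "'m::euclidean_space set \<Rightarrow> ('m \<Rightarrow> 'b::real_normed_vector) \<Rightarrow> 'm set \<Rightarrow> bool" where
  "C2_on S f X \<longleftrightarrow>
    (\<exists>(D1 :: 'm \<Rightarrow> 'm \<Rightarrow>\<^sub>L 'b) (D2 :: 'm \<Rightarrow> 'm \<Rightarrow>\<^sub>L ('m \<Rightarrow>\<^sub>L 'b)).
      (\<forall>x\<in>X. (f has_derivative blinfun_apply (D1 x)) (at x within S)) \<and>
      (\<forall>x\<in>X. (D1 has_derivative blinfun_apply (D2 x)) (at x within S)) \<and>
      continuous_on X D2)"

definition is_chart :: "'a topology \<Rightarrow> 'm::euclidean_space set \<Rightarrow> 'a set \<Rightarrow> ('a \<Rightarrow> 'm) \<Rightarrow> bool" where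
  "is_chart T S X \<phi> \<longleftrightarrow>
    openin T X \<and> openin (top_of_set S) (\<phi> ` X) \<and>
    homeomorphic_map (subtopology T X) (top_of_set (\<phi> ` X)) \<phi>"

definition smooth_manifold :: "('a, 'm::euclidean_space) manifold \<Rightarrow> bool" where
  "smooth_manifold M \<longleftrightarrow>
    Hausdorff_space (mtop M) \<and> second_countable (mtop M) \<and> subspace (model M) \<and>
    (\<forall>(X, \<phi>)\<in>atlas M. is_chart (mtop M) (model M) X \<phi>) \<and>
    (\<Union>(X, \<phi>)\<in>atlas M. X) = points M \<and>
    (\<forall>(X, \<phi>)\<in>atlas M. \<forall>(Y, \<psi>)\<in>atlas M.
      C2_on (model M) (\<psi> \<circ> inv_into X \<phi>) (\<phi> ` (X \<inter> Y)))"

definition smooth_map_on ::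
    "('a, 'm::euclidean_space) manifold \<Rightarrow> 'a set \<Rightarrow> ('a \<Rightarrow> 'b::real_normed_vector) \<Rightarrow> bool" where
  "smooth_map_on M W f \<longleftrightarrow>
    (\<forall>(X, \<phi>)\<in>atlas M. C2_on (model M) (f \<circ> inv_into X \<phi>) (\<phi> ` (X \<inter> W)))"

text \<open>The inclusion of the points into the surrounding Euclidean space is an immersion.\<close>

definition immersed_submanifold ::
    "('a::euclidean_space, 'm::euclidean_space) manifold \<Rightarrow> bool" where
  "immersed_submanifold M \<longleftrightarrow>
    smooth_manifold M \<and> smooth_map_on M (points M) (\<lambda>x. x) \<and>
    (\<forall>(X, \<phi>)\<in>atlas M. \<forall>p\<in>X. \<exists>D.
      (inv_into X \<phi> has_derivative D) (at (\<phi> p) within model M) \<and> inj_on D (model M))"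

text \<open>
  The tangent space of an immersed submanifold, as a subspace of the surrounding Euclidean space.
\<close>

definition tangent_space ::
    "('a::euclidean_space, 'm::euclidean_space) manifold \<Rightarrow> 'a \<Rightarrow> 'a set" where
  "tangent_space M p =
    {v. \<exists>(X, \<phi>)\<in>atlas M. p \<in> X \<and> (\<exists>D.
      (inv_into X \<phi> has_derivative D) (at (\<phi> p) within model M) \<and> v \<in> D ` model M)}"

text \<open>
  \<open>L\<close>, restricted to the tangent space at \<open>p\<close>, is the differential of \<open>f\<close> at \<open>p\<close>.
\<close>

definition has_differential ::
    "('a::euclidean_space, 'm::euclidean_space) manifold \<Rightarrow> ('a \<Rightarrow> 'b::real_normed_vector)
      \<Rightarrow> 'a \<Rightarrow> ('a \<Rightarrow> 'b) \<Rightarrow> bool" where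
  "has_differential M f p L \<longleftrightarrow>
    (\<forall>(X, \<phi>)\<in>atlas M. p \<in> X \<longrightarrow> (\<exists>D.
      (inv_into X \<phi> has_derivative D) (at (\<phi> p) within model M) \<and>
      ((f \<circ> inv_into X \<phi>) has_derivative (L \<circ> D)) (at (\<phi> p) within model M)))"

section \<open>The space of oriented lines\<close>

text \<open>
  The Euclidean space \<open>'a\<close> plays the role of the (n+1)-dimensional space, i.e. n + 1 is \<open>DIM('a)\<close>.
  Since the tangent bundle of the sphere is an embedded submanifold of \<open>'a \<times> 'a\<close>, its immersed
  submanifolds are the immersed submanifolds of \<open>'a \<times> 'a\<close> whose points belong to it.
\<close>

definition TSphere :: "('a::euclidean_space \<times> 'a) set" where
  "TSphere = {(\<xi>, \<eta>). norm \<xi> = 1 \<and> \<xi> \<bullet> \<eta> = 0}"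

definition Psi :: "('a::euclidean_space \<times> 'a) \<times> real \<Rightarrow> 'a" where
  "Psi = (\<lambda>((\<xi>, \<eta>), r). \<eta> + r *\<^sub>R \<xi>)"

text \<open>
  The bundle projection is the restriction of the linear map \<open>fst\<close>, which is therefore also its
  differential, and the round metric is the restriction of the inner product. The formula makes
  sense on all of \<open>'a \<times> 'a\<close>. As the exterior derivative commutes with restriction, \<open>Omega\<close> may
  be computed there and then be restricted to tangent vectors.
\<close>

definition liouville :: "'a::euclidean_space \<times> 'a \<Rightarrow> 'a \<times> 'a \<Rightarrow> real" where
  "liouville = (\<lambda>(\<xi>, \<eta>) X. fst X \<bullet> \<eta>)"

definition ext_deriv ::
    "('e::euclidean_space \<Rightarrow> 'e \<Rightarrow> real) \<Rightarrow> 'e \<Rightarrow> 'e \<Rightarrow> 'e \<Rightarrow> real" where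
  "ext_deriv \<omega> p X Y =
    frechet_derivative (\<lambda>q. \<omega> q Y) (at p) X - frechet_derivative (\<lambda>q. \<omega> q X) (at p) Y"

definition Omega :: "'a::euclidean_space \<times> 'a \<Rightarrow> 'a \<times> 'a \<Rightarrow> 'a \<times> 'a \<Rightarrow> real" where
  "Omega p X Y = - ext_deriv liouville p X Y"

lemma Omega_eq: "Omega p X Y = fst X \<bullet> snd Y - snd X \<bullet> fst Y"
proof -
  have "frechet_derivative (\<lambda>q. liouville q Z) (at p) = (\<lambda>V. fst Z \<bullet> snd V)" for Z :: "'a \<times> 'a"
    by (rule frechet_derivative_at[symmetric])
      (auto simp: liouville_def case_prod_unfold intro!: derivative_eq_intros)
  then show ?thesis
    by (simp add: Omega_def ext_deriv_def inner_commute)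
qed

definition isotropic ::
    "('a::euclidean_space \<times> 'a, 'm::euclidean_space) manifold \<Rightarrow> bool" where
  "isotropic \<Gamma> \<longleftrightarrow>
    (\<forall>p\<in>points \<Gamma>. \<forall>X\<in>tangent_space \<Gamma> p. \<forall>Y\<in>tangent_space \<Gamma> p. Omega p X Y = 0)"

text \<open>
  The tangent space of the product of \<open>\<Gamma>\<close> with the real line at \<open>(\<gamma>, r)\<close> is
  \<open>tangent_space \<Gamma> \<gamma> \<times> UNIV\<close>.
\<close>

definition focal_points ::
    "('a::euclidean_space \<times> 'a, 'm::euclidean_space) manifold \<Rightarrow> 'a set" where
  "focal_points \<Gamma> =
    {p. \<exists>\<gamma>\<in>points \<Gamma>. \<exists>r. Psi (\<gamma>, r) = p \<and>
      \<not> inj_on (frechet_derivative Psi (at (\<gamma>, r))) (tangent_space \<Gamma> \<gamma> \<times> UNIV)}"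

definition Phi :: "('a::euclidean_space \<Rightarrow> 'a) \<Rightarrow> 'a \<Rightarrow> 'a \<times> 'a" where
  "Phi \<nu> q = (\<nu> q, q - (\<nu> q \<bullet> q) *\<^sub>R \<nu> q)"

definition unit_normal_section ::
    "('a::euclidean_space, 'm::euclidean_space) manifold \<Rightarrow> ('a \<Rightarrow> 'a) \<Rightarrow> bool" where
  "unit_normal_section M \<nu> \<longleftrightarrow>
    smooth_map_on M (points M) \<nu> \<and>
    (\<forall>q\<in>points M. norm (\<nu> q) = 1 \<and> (\<forall>v\<in>tangent_space M q. \<nu> q \<bullet> v = 0))"

text \<open>
  \<open>Phi \<nu>\<close> is required to be a map into the manifold \<open>\<Gamma>\<close> and not merely into its set of points:
  it is continuous for the topology of \<open>\<Gamma>\<close>. This contains \<open>Phi \<nu> ` points M \<subseteq> points \<Gamma>\<close>, and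
  the two are equivalent when \<open>\<Gamma>\<close> has the subspace topology. A continuous \<open>Phi \<nu>\<close> is
  automatically smooth as a map into \<open>\<Gamma>\<close>.
\<close>

definition orthogonal_submanifold ::
    "('a::euclidean_space, 'm::euclidean_space) manifold
      \<Rightarrow> ('a \<times> 'a, 'k::euclidean_space) manifold \<Rightarrow> bool" where
  "orthogonal_submanifold M \<Gamma> \<longleftrightarrow>
    immersed_submanifold M \<and> dim (model M) > 0 \<and>
    (\<exists>\<nu>. unit_normal_section M \<nu> \<and> Phi \<nu> ` points M \<subseteq> points \<Gamma> \<and>
      continuous_map (mtop M) (mtop \<Gamma>) (Phi \<nu>))"

end

theory Submission
  imports Defs
begin

text \<open>
  Since \<open>\<Gamma>\<close> is isotropic, the Liouville form restricts to a closed form on \<open>\<Gamma>\<close>, hence has a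
  primitive \<open>F\<close> near \<open>Phi \<nu> p\<close>. Along \<open>\<U>\<close>, the differential of the support function
  \<open>\<nu> q \<bullet> q\<close> is \<open>v \<mapsto> d\<nu> v \<bullet> q\<close> because \<open>\<nu>\<close> is normal, and the pullback of the Liouville form by
  \<open>Phi \<nu>\<close> is the same form because \<open>d\<nu> v\<close> is orthogonal to \<open>\<nu>\<close>. So \<open>F \<circ> Phi \<nu>\<close> and the support
  function differ by a constant near \<open>p\<close>, which is absorbed into \<open>F\<close>; and \<open>q\<close> is recovered as
  \<open>Psi (Phi \<nu> q, \<nu> q \<bullet> q)\<close>.
\<close>

section \<open>Closed one-forms\<close>

text \<open>
  Both sides are the derivative at \<open>b = 0\<close> of \<open>D1 (x + b *\<^sub>R v) w\<close>: one directly, the other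
  after writing the increment of \<open>f\<close> in direction \<open>v\<close> as an integral and differentiating that
  integral in direction \<open>w\<close>.
\<close>

lemma second_derivative_symmetric:
  fixes f :: "'a::real_normed_vector \<Rightarrow> 'b::banach"
    and D1 :: "'a \<Rightarrow> 'a \<Rightarrow>\<^sub>L 'b" and D2 :: "'a \<Rightarrow> 'a \<Rightarrow>\<^sub>L ('a \<Rightarrow>\<^sub>L 'b)"
  assumes U: "open U" "x \<in> U"
    and D1: "\<And>x. x \<in> U \<Longrightarrow> (f has_derivative blinfun_apply (D1 x)) (at x)"
    and D2: "\<And>x. x \<in> U \<Longrightarrow> (D1 has_derivative blinfun_apply (D2 x)) (at x)"
    and cont: "continuous_on U D2"
  shows "D2 x v w = D2 x w v"
proof -
  obtain e where e: "e > 0" "ball x e \<subseteq> U"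
    using U by (meson openE)
  \<comment> \<open>The summand 1 keeps \<open>m\<close> positive when \<open>v\<close> and
    \<open>w\<close> vanish. The choice of \<open>a\<close> keeps every point
    \<open>x + s v + t w\<close> with \<open>|s|, |t| <= a\<close> within distance
    \<open>e / 2\<close> of \<open>x\<close>.\<close>
  define m where "m = norm v + norm w + 1"
  define a where "a = e / (2 * m)"
  have m: "m > 0"
    by (simp add: m_def add_nonneg_pos)
  then have a: "a > 0"
    using e m by (simp add: a_def)
  have inU: "x + s *\<^sub>R v + t *\<^sub>R w \<in> U" if "\<bar>s\<bar> \<le> a" "\<bar>t\<bar> \<le> a" for s t
  proof -
    have "norm (s *\<^sub>R v + t *\<^sub>R w) \<le> \<bar>s\<bar> * norm v + \<bar>t\<bar> * norm w"
      by (metis norm_scaleR norm_triangle_ineq)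
    also have "\<dots> \<le> a * norm v + a * norm w"
      using that by (intro add_mono mult_right_mono) auto
    also have "\<dots> \<le> a * m"
      using a by (simp add: m_def algebra_simps)
    also have "\<dots> = e / 2"
      using m by (simp add: a_def)
    also have "\<dots> < e"
      using e by simp
    finally show ?thesis
      using e(2) by (intro subsetD[OF e(2)]) (simp add: dist_norm norm_minus_commute add.commute add.left_commute)
  qed
  note D1' = has_derivative_eq_rhs[OF has_derivative_compose[where g = f, OF _ D1]]
  note D2' = has_derivative_eq_rhs[OF has_derivative_compose[where g = D1, OF _ D2]]
  have inc: "D1 (x + b *\<^sub>R v) w - D1 x w = integral {0..b} (\<lambda>s. D2 (x + s *\<^sub>R v) w v)"
    if b: "0 \<le> b" "b \<le> a" for b
  proof -
    have inc1: "((\<lambda>s. D1 (x + s *\<^sub>R v + t *\<^sub>R w) v) has_integral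
        f (x + b *\<^sub>R v + t *\<^sub>R w) - f (x + t *\<^sub>R w)) {0..b}" if "\<bar>t\<bar> \<le> a" for t
    proof -
      have "((\<lambda>s. f (x + s *\<^sub>R v + t *\<^sub>R w)) has_vector_derivative D1 (x + s *\<^sub>R v + t *\<^sub>R w) v)
          (at s within {0..b})" if "s \<in> {0..b}" for s
        unfolding has_vector_derivative_def using that b \<open>\<bar>t\<bar> \<le> a\<close>
        by (auto intro!: derivative_eq_intros D1' inU simp: blinfun.bilinear_simps)
      from fundamental_theorem_of_calculus[OF b(1) this]
      show ?thesis
        by simp
    qed
    let ?fx = "\<lambda>t s. D2 (x + s *\<^sub>R v + t *\<^sub>R w) w v"
    \<comment> \<open>The same function of \<open>t\<close> is differentiated at 0 in two ways:
      under the integral sign here, and below as the difference of values of \<open>f\<close> that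
      it equals by \<open>inc1\<close>.\<close>
    have "((\<lambda>t. integral (cbox 0 b) (\<lambda>s. D1 (x + s *\<^sub>R v + t *\<^sub>R w) v)) has_vector_derivative
        integral (cbox 0 b) (?fx 0)) (at 0 within {-a..a})"
    proof (rule leibniz_rule_vector_derivative)
      fix t s assume ts: "t \<in> {-a..a}" "s \<in> cbox 0 b"
      then have "\<bar>s\<bar> \<le> a" "\<bar>t\<bar> \<le> a"
        using b by auto
      then show "((\<lambda>t. D1 (x + s *\<^sub>R v + t *\<^sub>R w) v) has_vector_derivative ?fx t s) (at t within {-a..a})"
        unfolding has_vector_derivative_def
        by (auto intro!: derivative_eq_intros D2' inU simp: blinfun.bilinear_simps)
    next
      fix t assume "t \<in> {-a..a}"
      then show "(\<lambda>s. D1 (x + s *\<^sub>R v + t *\<^sub>R w) v) integrable_on cbox 0 b"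
        using inc1[of t] by (auto simp: abs_le_iff)
    next
      show "continuous_on ({-a..a} \<times> cbox 0 b) (\<lambda>(t, s). ?fx t s)"
        unfolding case_prod_unfold using b
        by (auto intro!: continuous_intros continuous_on_compose2[OF cont] inU)
    qed (use a in auto)
    moreover have "((\<lambda>t. integral (cbox 0 b) (\<lambda>s. D1 (x + s *\<^sub>R v + t *\<^sub>R w) v)) has_vector_derivative
        D1 (x + b *\<^sub>R v) w - D1 x w) (at 0 within {-a..a})"
    proof (rule has_vector_derivative_transform)
      show "((\<lambda>t. f (x + b *\<^sub>R v + t *\<^sub>R w) - f (x + t *\<^sub>R w)) has_vector_derivative
        D1 (x + b *\<^sub>R v) w - D1 x w) (at 0 within {-a..a})"
        unfolding has_vector_derivative_def using inU[of b 0] inU[of 0 0] a b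
        by (auto intro!: derivative_eq_intros D1' simp: blinfun.bilinear_simps algebra_simps)
    qed (use a inc1 in \<open>auto intro!: integral_unique simp: abs_le_iff\<close>)
    ultimately show ?thesis
      using vector_derivative_unique_within_closed_interval[of "-a" a 0] a
      by (auto simp: cbox_interval)
  qed
  \<comment> \<open>Both sides of \<open>inc\<close> are now differentiated in \<open>b\<close> at
    0. Since \<open>b\<close> is nonnegative there, the derivatives are one-sided.\<close>
  have "((\<lambda>b. integral {0..b} (\<lambda>s. D2 (x + s *\<^sub>R v) w v)) has_vector_derivative D2 (x + 0 *\<^sub>R v) w v)
      (at 0 within {0..a})"
    using a inU[of _ 0]
    by (intro integral_has_vector_derivative)
      (auto intro!: continuous_intros continuous_on_compose2[OF cont])
  moreover have "((\<lambda>b. integral {0..b} (\<lambda>s. D2 (x + s *\<^sub>R v) w v)) has_vector_derivative D2 x v w)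
      (at 0 within {0..a})"
  proof (rule has_vector_derivative_transform)
    show "((\<lambda>b. D1 (x + b *\<^sub>R v) w - D1 x w) has_vector_derivative D2 x v w) (at 0 within {0..a})"
      unfolding has_vector_derivative_def using inU[of 0 0] a
      by (auto intro!: derivative_eq_intros D2' simp: blinfun.bilinear_simps)
  qed (use a inc in auto)
  ultimately show ?thesis
    using vector_derivative_unique_within_closed_interval[of 0 a 0] a
    by (auto simp: cbox_interval)
qed

text \<open>Poincare lemma for convex domains: the primitive at \<open>x\<close> is the integral of
  the form along the segment from a fixed point \<open>c\<close> to \<open>x\<close>. Symmetry of
  \<open>A\<close> expresses closedness and turns the derivative of that integral into a total
  derivative in the segment parameter.\<close>

lemma closed_one_form_exact:
  fixes \<alpha> :: "'a::banach \<Rightarrow> 'a \<Rightarrow>\<^sub>L 'b::banach" and A :: "'a \<Rightarrow> 'a \<Rightarrow>\<^sub>L ('a \<Rightarrow>\<^sub>L 'b)"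
  assumes U: "open U" "convex U"
    and deriv: "\<And>x. x \<in> U \<Longrightarrow> (\<alpha> has_derivative blinfun_apply (A x)) (at x)"
    and cont: "continuous_on U A"
    and sym: "\<And>x v w. x \<in> U \<Longrightarrow> A x v w = A x w v"
  shows "\<exists>F. \<forall>x\<in>U. (F has_derivative blinfun_apply (\<alpha> x)) (at x)"
proof (cases "U = {}")
  case False
  then obtain c where c: "c \<in> U"
    by auto
  have inU: "c + t *\<^sub>R (x - c) \<in> U" if "x \<in> U" "0 \<le> t" "t \<le> 1" for x t
    using convexD_alt[OF U(2) c that] by (simp add: algebra_simps)
  have cont': "continuous_on U \<alpha>"
    by (intro continuous_at_imp_continuous_on ballI has_derivative_continuous[OF deriv])
  note deriv' = has_derivative_compose[where g = \<alpha>, OF _ deriv]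
  define f where "f x t = \<alpha> (c + t *\<^sub>R (x - c)) (x - c)" for x and t :: real
  \<comment> \<open>The derivative of \<open>f x t\<close> in \<open>x\<close> by the product rule:
    the first summand comes from the moving base point, whence the factor \<open>t\<close>, and the
    second from the vector \<open>x - c\<close>.\<close>
  define fx where "fx x t = t *\<^sub>R (blinfun.prod_left (x - c) o\<^sub>L A (c + t *\<^sub>R (x - c))) + \<alpha> (c + t *\<^sub>R (x - c))"
    for x and t :: real
  have contf: "continuous_on (U \<times> {0..1}) (\<lambda>(x, t). fx x t)"
    unfolding fx_def case_prod_unfold
    by (auto intro!: continuous_intros continuous_on_compose2[OF cont] continuous_on_compose2[OF cont']
      bounded_linear.continuous_on[OF blinfun.bounded_linear_prod_left] inU)
  have "((\<lambda>x. integral (cbox 0 1) (f x)) has_derivative blinfun_apply (\<alpha> x)) (at x)" if x: "x \<in> U" for x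
  proof -
    have "((\<lambda>x. integral (cbox 0 1) (f x)) has_derivative blinfun_apply (integral (cbox 0 1) (fx x)))
        (at x within U)"
    proof (rule leibniz_rule)
      fix y t assume yt: "y \<in> U" "t \<in> cbox 0 (1::real)"
      have "((\<lambda>x. \<alpha> (c + t *\<^sub>R (x - c))) has_derivative (\<lambda>v. A (c + t *\<^sub>R (y - c)) (t *\<^sub>R v))) (at y within U)"
        using yt by (intro deriv' inU) (auto intro!: derivative_eq_intros)
      moreover have "((\<lambda>x. x - c) has_derivative (\<lambda>v. v)) (at y within U)"
        by (auto intro!: derivative_eq_intros)
      ultimately show "((\<lambda>x. f x t) has_derivative blinfun_apply (fx y t)) (at y within U)"
        unfolding f_def fx_def
        by (rule has_derivative_eq_rhs[OF blinfun.FDERIV])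
          (simp add: fun_eq_iff blinfun.add_left blinfun.scaleR_left blinfun.scaleR_right)
    next
      fix y assume "y \<in> U"
      then show "f y integrable_on cbox 0 1"
        unfolding f_def
        by (intro integrable_continuous)
          (auto intro!: continuous_intros continuous_on_compose2[OF cont'] inU simp: cbox_interval)
    next
      show "continuous_on (U \<times> cbox 0 1) (\<lambda>(x, t). fx x t)"
        using contf by (simp add: cbox_interval)
    qed (fact x U(2))+
    moreover have "integral (cbox 0 1) (fx x) = \<alpha> x"
    proof (rule blinfun_eqI)
      fix v
      have "continuous_on {0..1} (fx x)"
        using x continuous_on_compose2[OF contf, of "{0..1}" "\<lambda>t. (x, t)"]
        by (simp add: image_subset_iff continuous_on_Pair)
      then have int: "fx x integrable_on cbox 0 1"
        by (intro integrable_continuous) (simp add: cbox_interval)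
      \<comment> \<open>The integrand has \<open>A\<close> applied to \<open>v\<close> first and
        \<open>x - c\<close> second, while differentiating along the segment gives the opposite
        order. \<open>sym\<close> exchanges them.\<close>
      have "((\<lambda>t. t *\<^sub>R \<alpha> (c + t *\<^sub>R (x - c)) v) has_vector_derivative fx x t v) (at t within {0..1})"
        if "t \<in> {0..1}" for t
      proof -
        have "((\<lambda>t. \<alpha> (c + t *\<^sub>R (x - c))) has_derivative (\<lambda>s. A (c + t *\<^sub>R (x - c)) (s *\<^sub>R (x - c))))
            (at t within {0..1})"
          using that by (intro deriv' inU x) (auto intro!: derivative_eq_intros)
        then have "((\<lambda>t. \<alpha> (c + t *\<^sub>R (x - c)) v) has_derivative (\<lambda>s. s *\<^sub>R A (c + t *\<^sub>R (x - c)) v (x - c)))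
            (at t within {0..1})"
          using that sym[OF inU[OF x], of t v "x - c"]
          by (auto intro!: derivative_eq_intros simp: blinfun.scaleR_left blinfun.scaleR_right)
        from has_derivative_scaleR[OF has_derivative_ident this] show ?thesis
          unfolding has_vector_derivative_def fx_def
          by (rule has_derivative_eq_rhs)
            (simp add: fun_eq_iff blinfun.add_left blinfun.scaleR_left scaleR_add_right mult.commute)
      qed
      then have "((\<lambda>t. fx x t v) has_integral
          1 *\<^sub>R \<alpha> (c + 1 *\<^sub>R (x - c)) v - 0 *\<^sub>R \<alpha> (c + 0 *\<^sub>R (x - c)) v) {0..1}"
        by (intro fundamental_theorem_of_calculus) auto
      then have "integral {0..1} (\<lambda>t. fx x t v) = \<alpha> x v"
        by (simp add: integral_unique)
      then show "blinfun_apply (integral (cbox 0 1) (fx x)) v = \<alpha> x v"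
        unfolding blinfun_apply_integral[OF int] by (simp only: cbox_interval)
    qed
    ultimately show ?thesis
      unfolding at_within_open[OF x U(1)] by simp
  qed
  then show ?thesis
    by (intro exI ballI)
qed simp

section \<open>Retractions onto a linear subspace\<close>

text \<open>
  Composing with such a retraction turns derivatives within \<open>S\<close>, which are only determined on \<open>S\<close>,
  into ordinary, unique derivatives on open sets.
\<close>

lemma linear_retraction_exists:
  fixes S :: "'a::euclidean_space set"
  assumes "subspace S"
  obtains P :: "'a \<Rightarrow>\<^sub>L 'a" where "\<And>x. P x \<in> S" "\<And>x. x \<in> S \<Longrightarrow> P x = x"
proof -
  have "linear (\<lambda>x::'a. x)"
    by (simp add: linear_iff)
  \<comment> \<open>A left inverse on \<open>S\<close> of the identity map, with range in
    \<open>S\<close>, is a linear projection onto \<open>S\<close>.\<close>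
  from real_vector.linear_exists_left_inverse_on[OF this assms, of] obtain p
    where p: "range p \<subseteq> S" "linear p" "\<forall>v\<in>S. p v = v"
    by auto
  then have "blinfun_apply (Blinfun p) = p"
    by (simp add: bounded_linear_Blinfun_apply linear_conv_bounded_linear)
  then show ?thesis
    using p that[of "Blinfun p"] by auto
qed

lemma at_within_openin:
  assumes "openin (top_of_set S) T" "x \<in> T"
  shows "at x within T = at x within S"
proof -
  obtain U where "open U" "T = S \<inter> U"
    using assms(1) by (auto simp: openin_open)
  then show ?thesis
    using assms(2) by (intro at_within_nhd[of x U]) auto
qed

lemma has_derivative_compose_retraction:
  fixes P :: "'m::euclidean_space \<Rightarrow>\<^sub>L 'm"
  assumes "\<And>x. P x \<in> S" "(f has_derivative D) (at (P x) within S)"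
  shows "((\<lambda>x. f (P x)) has_derivative (\<lambda>v. D (P v))) (at x)"
  using assms
  by (intro has_derivative_in_compose[where g = f and f = P] bounded_linear_imp_has_derivative
      blinfun.bounded_linear_right) (auto elim: has_derivative_subset)

text \<open>Precomposition with a retraction gives derivatives at a full neighbourhood filter, where
  they are unique, and loses nothing on \<open>S\<close>.\<close>

lemma has_derivative_within_subspace_unique:
  fixes f :: "'m::euclidean_space \<Rightarrow> 'b::real_normed_vector"
  assumes S: "subspace S" "x \<in> S" and v: "v \<in> S"
    and D: "(f has_derivative D) (at x within S)" "(f has_derivative E) (at x within S)"
  shows "D v = E v"
proof -
  obtain P :: "'m \<Rightarrow>\<^sub>L 'm" where P: "\<And>x. P x \<in> S" "\<And>x. x \<in> S \<Longrightarrow> P x = x"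
    using linear_retraction_exists[OF S(1)] by metis
  have "(\<lambda>v. D (P v)) = (\<lambda>v. E (P v))"
    using D S(2) P has_derivative_unique[OF has_derivative_compose_retraction[OF P(1), of f D x]
        has_derivative_compose_retraction[OF P(1), of f E x]]
    by simp
  then show ?thesis
    using P(2)[OF v] by metis
qed

lemma open_vimage_retraction:
  fixes P :: "'m::euclidean_space \<Rightarrow>\<^sub>L 'm"
  assumes "\<And>x. P x \<in> S" "openin (top_of_set S) T"
  shows "open (blinfun_apply P -` T)"
proof -
  obtain U where "open U" "T = S \<inter> U"
    using assms(2) by (auto simp: openin_open)
  moreover from this have "blinfun_apply P -` T = blinfun_apply P -` U"
    using assms(1) by auto
  ultimately show ?thesis
    using open_vimage[OF _ linear_continuous_on[OF blinfun.bounded_linear_right]] by metis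
qed

lemma C2_onE:
  assumes "C2_on S f X"
  obtains D1 D2 where "\<And>x. x \<in> X \<Longrightarrow> (f has_derivative blinfun_apply (D1 x)) (at x within S)"
    and "\<And>x. x \<in> X \<Longrightarrow> (D1 has_derivative blinfun_apply (D2 x)) (at x within S)"
    and "continuous_on X D2"
  using assms unfolding C2_on_def by blast

lemma C2_on_compose_retraction:
  fixes P :: "'m::euclidean_space \<Rightarrow>\<^sub>L 'm"
  assumes P: "\<And>x. P x \<in> S" and f: "C2_on S f X"
  shows "C2_on UNIV (\<lambda>x. f (P x)) (blinfun_apply P -` X)"
proof -
  obtain D1 D2 where D1: "\<And>x. x \<in> X \<Longrightarrow> (f has_derivative blinfun_apply (D1 x)) (at x within S)"
    and D2: "\<And>x. x \<in> X \<Longrightarrow> (D1 has_derivative blinfun_apply (D2 x)) (at x within S)"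
    and cont: "continuous_on X D2"
    using C2_onE[OF f] by metis
  \<comment> \<open>Chain rule for \<open>D1 (P x) o\<^sub>L P\<close>: the right factor
    \<open>P\<close> is constant, so composing with it is a bounded linear operation on
    \<open>D1 (P x)\<close>.\<close>
  let ?D2 = "\<lambda>x. bounded_bilinear.prod_left (o\<^sub>L) P o\<^sub>L (D2 (P x) o\<^sub>L P)"
  show ?thesis
    unfolding C2_on_def
  proof (intro exI[of _ "\<lambda>x. D1 (P x) o\<^sub>L P"] exI[of _ ?D2] conjI ballI)
    fix x assume x: "x \<in> blinfun_apply P -` X"
    show "((\<lambda>x. f (P x)) has_derivative blinfun_apply (D1 (P x) o\<^sub>L P)) (at x)"
      using has_derivative_compose_retraction[OF P D1] x by (simp add: blinfun_compose.rep_eq comp_def)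
    have "((\<lambda>x. D1 (P x)) has_derivative (\<lambda>v. D2 (P x) (P v))) (at x)"
      using has_derivative_compose_retraction[OF P D2] x by simp
    then show "((\<lambda>x. D1 (P x) o\<^sub>L P) has_derivative blinfun_apply (?D2 x)) (at x)"
      by (auto intro!: derivative_eq_intros
          simp: bounded_bilinear.prod_left.rep_eq[OF bounded_bilinear_blinfun_compose])
  next
    show "continuous_on (blinfun_apply P -` X) ?D2"
      by (auto intro!: continuous_intros continuous_on_compose2[OF cont])
  qed
qed

section \<open>Differentiation on immersed submanifolds\<close>

text \<open>Continuity of \<open>h\<close> suffices because the error is measured by the increment
  of \<open>h\<close> and not by that of its argument.\<close>

lemma has_derivative_compose_eventually:
  fixes f :: "'m::real_normed_vector \<Rightarrow> 'b::real_normed_vector"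
  assumes f: "(f has_derivative f') (at (h x) within S)"
    and h: "continuous (at x within T) h" "h ` T \<subseteq> S" and e: "e > 0"
  shows "\<forall>\<^sub>F y in at x within T. norm (f (h y) - f (h x) - f' (h y - h x)) \<le> e * norm (h y - h x)"
proof -
  obtain d where d: "d > 0"
    "\<And>z. z \<in> S \<Longrightarrow> norm (z - h x) < d \<Longrightarrow> norm (f z - f (h x) - f' (z - h x)) \<le> e * norm (z - h x)"
    using f e unfolding has_derivative_within_alt by blast
  have "\<forall>\<^sub>F y in at x within T. dist (h y) (h x) < d"
    using h(1) d(1) unfolding continuous_within by (rule tendstoD)
  moreover have "\<forall>\<^sub>F y in at x within T. y \<in> T"
    by (simp add: eventually_at_filter)
  ultimately show ?thesis
    by eventually_elim (use h(2) d(2) in \<open>auto simp: dist_norm\<close>)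
qed

text \<open>
  The map \<open>h\<close> is merely continuous. As \<open>g\<close> expands distances from \<open>h x\<close> at least linearly, \<open>h\<close> is
  Lipschitz at \<open>x\<close>; and \<open>f - L \<circ> g\<close> has derivative 0 at \<open>h x\<close>.
\<close>

lemma has_derivative_factor_through_immersion:
  fixes g :: "'m::euclidean_space \<Rightarrow> 'e::euclidean_space" and f :: "'m \<Rightarrow> 'b::real_normed_vector"
    and h :: "'n::real_normed_vector \<Rightarrow> 'm"
  assumes S: "subspace S"
    and g: "(g has_derivative D) (at (h x) within S)" "inj_on D S"
    and f: "(f has_derivative (L \<circ> D)) (at (h x) within S)" and L: "bounded_linear L"
    and h: "continuous (at x within T) h" "h ` T \<subseteq> S" "x \<in> T"
    and gh: "((\<lambda>y. g (h y)) has_derivative E) (at x within T)"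
  shows "((\<lambda>y. f (h y)) has_derivative (L \<circ> E)) (at x within T)"
proof -
  interpret D: bounded_linear D
    using g(1) by (rule has_derivative_bounded_linear)
  interpret E: bounded_linear E
    using gh by (rule has_derivative_bounded_linear)
  have "\<forall>v\<in>S. D v = 0 \<longrightarrow> v = 0"
    using g(2) S D.zero by (metis inj_onD subspace_0)
  then obtain c where c: "c > 0" "\<And>v. v \<in> S \<Longrightarrow> norm (D v) \<ge> c * norm v"
    using injective_imp_isometric[OF closed_subspace[OF S] S D.bounded_linear_axioms] by blast
  obtain M where M: "M > 0" "\<And>v. norm (E v) \<le> norm v * M"
    using E.pos_bounded by blast
  \<comment> \<open>Near \<open>x\<close>, \<open>c / 2 * norm (h y - h x)\<close> is at most
    \<open>norm (g (h y) - g (h x))\<close>, which is at most \<open>(M + 1) * norm (y - x)\<close>.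
    The other half of \<open>c\<close> absorbs the linearization error of \<open>g\<close>.\<close>
  define C where "C = 2 * (M + 1) / c"
  have C: "C > 0"
    using c M by (simp add: C_def)
  have "\<forall>\<^sub>F y in at x within T. norm (g (h y) - g (h x) - D (h y - h x)) \<le> c / 2 * norm (h y - h x)"
    using c(1) by (intro has_derivative_compose_eventually[OF g(1) h(1,2)]) simp
  moreover have "\<forall>\<^sub>F y in at x within T. norm (g (h y) - g (h x) - E (y - x)) \<le> 1 * norm (y - x)"
    using gh unfolding has_derivative_within_alt2 by (metis zero_less_one)
  moreover have T: "\<forall>\<^sub>F y in at x within T. y \<in> T"
    by (simp add: eventually_at_filter)
  ultimately have lip: "\<forall>\<^sub>F y in at x within T. norm (h y - h x) \<le> C * norm (y - x)"
  proof eventually_elim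
    case (elim y)
    have "h y - h x \<in> S"
      using elim(3) h S by (auto intro: subspace_diff)
    then have "c * norm (h y - h x) \<le> norm (D (h y - h x))"
      by (rule c)
    also have "\<dots> \<le> norm (g (h y) - g (h x)) + norm (g (h y) - g (h x) - D (h y - h x))"
      by (metis norm_minus_commute norm_triangle_sub)
    also have "\<dots> \<le> norm (g (h y) - g (h x)) + c / 2 * norm (h y - h x)"
      using elim(1) by simp
    finally have 1: "c / 2 * norm (h y - h x) \<le> norm (g (h y) - g (h x))"
      by simp
    have "norm (g (h y) - g (h x)) \<le> norm (E (y - x)) + norm (g (h y) - g (h x) - E (y - x))"
      by (rule norm_triangle_sub)
    also have "\<dots> \<le> (M + 1) * norm (y - x)"
      using elim(2) M(2)[of "y - x"] by (simp add: algebra_simps)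
    finally show ?case
      using 1 c(1) by (simp add: C_def field_simps)
  qed
  define k where "k = (\<lambda>z. f z - L (g z))"
  have k: "(k has_derivative (\<lambda>_. 0)) (at (h x) within S)"
    unfolding k_def using has_derivative_diff[OF f bounded_linear.has_derivative[OF L g(1)]]
    by (simp add: comp_def)
  have "((\<lambda>y. k (h y)) has_derivative (\<lambda>_. 0)) (at x within T)"
    unfolding has_derivative_within_alt2
  proof (intro conjI allI impI)
    fix e :: real
    assume "e > 0"
    then have "e / C > 0"
      using C by simp
    from has_derivative_compose_eventually[OF k h(1,2) this] lip
    show "\<forall>\<^sub>F y in at x within T. norm (k (h y) - k (h x) - 0) \<le> e * norm (y - x)"
    proof eventually_elim
      case (elim y)
      have "norm (k (h y) - k (h x) - 0) \<le> e / C * norm (h y - h x)"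
        using elim(1) by simp
      also have "\<dots> \<le> e / C * (C * norm (y - x))"
        using elim(2) \<open>e / C > 0\<close> by (intro mult_left_mono) auto
      finally show ?case
        using C by simp
    qed
  qed (rule bounded_linear_zero)
  \<comment> \<open>Here \<open>f\<close> composed with \<open>h\<close> is split as
    \<open>k\<close> composed with \<open>h\<close> plus \<open>L\<close> applied to
    \<open>g\<close> composed with \<open>h\<close>.\<close>
  from has_derivative_add[OF this bounded_linear.has_derivative[OF L gh]] show ?thesis
    by (simp add: k_def comp_def)
qed

section \<open>Charts, differentials and the chain rule\<close>

lemma is_chart_inv_into:
  assumes "is_chart T S X \<phi>"
  shows "inj_on \<phi> X" "continuous_map (top_of_set (\<phi> ` X)) (subtopology T X) (inv_into X \<phi>)"
    "continuous_map (subtopology T X) (top_of_set (\<phi> ` X)) \<phi>" "X \<subseteq> topspace T"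
    "openin T X" "openin (top_of_set S) (\<phi> ` X)" "\<phi> ` X \<subseteq> S"
proof -
  have hom: "homeomorphic_map (subtopology T X) (top_of_set (\<phi> ` X)) \<phi>"
    and X: "openin T X" and S: "openin (top_of_set S) (\<phi> ` X)"
    using assms by (auto simp: is_chart_def)
  then show sub: "X \<subseteq> topspace T" "openin T X" "openin (top_of_set S) (\<phi> ` X)" "\<phi> ` X \<subseteq> S"
    using openin_subset[OF X] openin_imp_subset[OF S] by auto
  then have top: "topspace (subtopology T X) = X"
    by auto
  obtain \<psi> where \<psi>: "homeomorphic_maps (subtopology T X) (top_of_set (\<phi> ` X)) \<phi> \<psi>"
    using hom by (auto simp: homeomorphic_map_maps)
  then have inv: "\<And>x. x \<in> X \<Longrightarrow> \<psi> (\<phi> x) = x"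
    using top by (auto simp: homeomorphic_maps_def)
  then show inj: "inj_on \<phi> X"
    by (metis inj_onI)
  show "continuous_map (subtopology T X) (top_of_set (\<phi> ` X)) \<phi>"
    using \<psi> by (simp add: homeomorphic_maps_def)
  show "continuous_map (top_of_set (\<phi> ` X)) (subtopology T X) (inv_into X \<phi>)"
  proof (rule continuous_map_eq)
    show "continuous_map (top_of_set (\<phi> ` X)) (subtopology T X) \<psi>"
      using \<psi> by (simp add: homeomorphic_maps_def)
  qed (use inv inj in auto)
qed

lemma is_chart_openin_vimage:
  assumes "is_chart T S X \<phi>" "open B"
  shows "openin T {w \<in> X. \<phi> w \<in> B}"
proof -
  note chart = is_chart_inv_into[OF assms(1)]
  have "continuous_map (subtopology T X) euclidean \<phi>"
    using chart(3) by (simp add: continuous_map_in_subtopology)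
  from openin_continuous_map_preimage[OF this, of B] assms(2)
  have "openin (subtopology T X) {w \<in> topspace (subtopology T X). \<phi> w \<in> B}"
    by simp
  moreover have "topspace (subtopology T X) = X"
    by (rule topspace_subtopology_subset[OF chart(4)])
  ultimately show ?thesis
    using openin_trans_full[OF _ chart(5)] by (simp only:)
qed

lemma immersed_submanifoldD:
  assumes "immersed_submanifold M" "(X, \<phi>) \<in> atlas M"
  shows "is_chart (mtop M) (model M) X \<phi>" "subspace (model M)" "X \<subseteq> points M"
    "C2_on (model M) (inv_into X \<phi>) (\<phi> ` X)"
proof -
  show chart: "is_chart (mtop M) (model M) X \<phi>" and "subspace (model M)"
    using assms by (auto simp: immersed_submanifold_def smooth_manifold_def)
  show X: "X \<subseteq> points M"
    using is_chart_inv_into[OF chart] by (simp add: points_def)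
  have "C2_on (model M) ((\<lambda>x. x) \<circ> inv_into X \<phi>) (\<phi> ` (X \<inter> points M))"
    using assms by (auto simp: immersed_submanifold_def smooth_map_on_def)
  moreover have "X \<inter> points M = X"
    using X by blast
  ultimately show "C2_on (model M) (inv_into X \<phi>) (\<phi> ` X)"
    by (simp add: comp_def)
qed

text \<open>The definition of an immersion provides one injective derivative; uniqueness on the
  model space passes injectivity on to every derivative.\<close>

lemma immersed_submanifold_derivative:
  assumes M: "immersed_submanifold M" "(X, \<phi>) \<in> atlas M" "p \<in> X"
    and D: "(inv_into X \<phi> has_derivative D) (at (\<phi> p) within model M)"
  shows "inj_on D (model M)" "v \<in> model M \<Longrightarrow> D v \<in> tangent_space M p"
proof -
  obtain E where E: "(inv_into X \<phi> has_derivative E) (at (\<phi> p) within model M)" "inj_on E (model M)"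
    using M by (fastforce simp: immersed_submanifold_def)
  have "\<phi> p \<in> model M"
    using is_chart_inv_into[OF immersed_submanifoldD(1)[OF M(1,2)]] M(3) by auto
  then have "D v = E v" if "v \<in> model M" for v
    using has_derivative_within_subspace_unique[OF immersed_submanifoldD(2)[OF M(1,2)] _ that D E(1)]
    by blast
  then show "inj_on D (model M)"
    using E(2) by (simp add: inj_on_def)
  show "D v \<in> tangent_space M p" if "v \<in> model M"
    using M D that unfolding tangent_space_def by blast
qed

text \<open>The coordinate map \<open>\<phi>\<close> composed with \<open>u\<close> is known only to
  be continuous, so the usual chain rule does not apply. Factoring through the immersion
  \<open>inv_into X \<phi>\<close> does. Continuity of \<open>u\<close> refers to the topology of
  \<open>M\<close>, which makes \<open>u\<close> stay in the chart near \<open>y\<close>.\<close>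

lemma chain_rule_in_chart:
  fixes u :: "'n::euclidean_space \<Rightarrow> 'a::euclidean_space" and f :: "'a \<Rightarrow> 'b::real_normed_vector"
  assumes M: "immersed_submanifold M" "(X, \<phi>) \<in> atlas M" and L: "bounded_linear L"
    and D: "(inv_into X \<phi> has_derivative D) (at (\<phi> (u y)) within model M)"
      "((f \<circ> inv_into X \<phi>) has_derivative (L \<circ> D)) (at (\<phi> (u y)) within model M)"
    and u: "continuous_map (top_of_set T) (mtop M) u" "(u has_derivative E) (at y within T)"
    and y: "y \<in> T" "u y \<in> X"
  shows "((f \<circ> u) has_derivative (L \<circ> E)) (at y within T)"
proof -
  note chart = is_chart_inv_into[OF immersed_submanifoldD(1)[OF M]]
  define T' where "T' = {x \<in> T. u x \<in> X}"
  have T': "openin (top_of_set T) T'" "y \<in> T'"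
    using openin_continuous_map_preimage[OF u(1) chart(5)] y by (auto simp: T'_def)
  have at_T': "at y within T' = at y within T"
    by (rule at_within_openin[OF T'])
  have inv: "inv_into X \<phi> (\<phi> (u x)) = u x" if "x \<in> T'" for x
    using that chart(1) by (simp add: T'_def)
  have "continuous_map (top_of_set T') (subtopology (mtop M) X) u"
    using continuous_map_from_subtopology[OF u(1), of T']
    by (auto simp: continuous_map_in_subtopology subtopology_subtopology T'_def Collect_conj_eq Int_absorb1)
  from continuous_map_compose[OF this chart(3)] have cont: "continuous_on T' (\<lambda>x. \<phi> (u x))"
    by (auto simp: continuous_map_in_subtopology comp_def)
  have "((\<lambda>x. (f \<circ> inv_into X \<phi>) (\<phi> (u x))) has_derivative (L \<circ> E)) (at y within T')"
  proof (rule has_derivative_factor_through_immersion[where h = "\<lambda>x. \<phi> (u x)" and x = y,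
        OF immersed_submanifoldD(2)[OF M] D(1) _ D(2) L])
    show "inj_on D (model M)"
      by (rule immersed_submanifold_derivative[OF M y(2) D(1)])
    show "continuous (at y within T') (\<lambda>x. \<phi> (u x))"
      using cont T'(2) by (simp add: continuous_on_eq_continuous_within)
    show "(\<lambda>x. \<phi> (u x)) ` T' \<subseteq> model M"
      using chart(7) by (auto simp: T'_def)
    show "((\<lambda>x. inv_into X \<phi> (\<phi> (u x))) has_derivative E) (at y within T')"
      using u(2)[folded at_T'] by (rule has_derivative_transform[rotated 2]) (use T'(2) inv in auto)
  qed (fact T'(2))
  then have "((f \<circ> u) has_derivative (L \<circ> E)) (at y within T')"
    by (rule has_derivative_transform[rotated 2]) (use T'(2) inv in auto)
  then show ?thesis
    by (simp only: at_T')
qed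

lemma has_differential_chain:
  fixes u :: "'n::euclidean_space \<Rightarrow> 'a::euclidean_space"
  assumes M: "immersed_submanifold M" and L: "bounded_linear L"
    and f: "has_differential M f (u y) L"
    and u: "continuous_map (top_of_set T) (mtop M) u" "(u has_derivative E) (at y within T)" "y \<in> T"
  shows "((f \<circ> u) has_derivative (L \<circ> E)) (at y within T)"
proof -
  have "u y \<in> points M"
    using continuous_map_image_subset_topspace[OF u(1)] u(3) by (auto simp: points_def)
  then obtain X \<phi> where X: "(X, \<phi>) \<in> atlas M" "u y \<in> X"
    using M unfolding immersed_submanifold_def smooth_manifold_def by blast
  then obtain D where "(inv_into X \<phi> has_derivative D) (at (\<phi> (u y)) within model M)"
    "((f \<circ> inv_into X \<phi>) has_derivative (L \<circ> D)) (at (\<phi> (u y)) within model M)"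
    using f by (fastforce simp: has_differential_def)
  then show ?thesis
    by (rule chain_rule_in_chart[OF M X(1) L _ _ u X(2)])
qed

text \<open>Independence of the chart: the chain rule, applied to the inverse of any other chart,
  carries the differential over to it.\<close>

lemma has_differential_from_chart:
  assumes M: "immersed_submanifold M" "(X, \<phi>) \<in> atlas M" "p \<in> X" and L: "bounded_linear L"
    and D: "(inv_into X \<phi> has_derivative D) (at (\<phi> p) within model M)"
      "((f \<circ> inv_into X \<phi>) has_derivative (L \<circ> D)) (at (\<phi> p) within model M)"
  shows "has_differential M f p L"
  unfolding has_differential_def
proof (clarify)
  fix Y \<psi>
  assume Y: "(Y, \<psi>) \<in> atlas M" "p \<in> Y"
  note chart = is_chart_inv_into[OF immersed_submanifoldD(1)[OF M(1) Y(1)]]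
  obtain E where E: "(inv_into Y \<psi> has_derivative E) (at (\<psi> p) within model M)"
    using M(1) Y by (fastforce simp: immersed_submanifold_def)
  have p: "inv_into Y \<psi> (\<psi> p) = p" "\<psi> p \<in> \<psi> ` Y"
    using chart(1) Y(2) by auto
  have at: "at (\<psi> p) within \<psi> ` Y = at (\<psi> p) within model M"
    by (rule at_within_openin[OF chart(6) p(2)])
  have "((f \<circ> inv_into Y \<psi>) has_derivative (L \<circ> E)) (at (\<psi> p) within \<psi> ` Y)"
  proof (rule chain_rule_in_chart[OF M(1,2) L])
    show "continuous_map (top_of_set (\<psi> ` Y)) (mtop M) (inv_into Y \<psi>)"
      using chart(2) by (simp add: continuous_map_in_subtopology)
  qed (use D E p M(3) at in simp_all)
  then show "\<exists>D. (inv_into Y \<psi> has_derivative D) (at (\<psi> p) within model M) \<and>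
      ((f \<circ> inv_into Y \<psi>) has_derivative (L \<circ> D)) (at (\<psi> p) within model M)"
    using E at by auto
qed

lemma has_differential_add_const:
  assumes "has_differential M f p L"
  shows "has_differential M (\<lambda>x. f x + c) p L"
  unfolding has_differential_def
proof (clarify)
  fix X \<phi>
  assume "(X, \<phi>) \<in> atlas M" "p \<in> X"
  then obtain D where D: "(inv_into X \<phi> has_derivative D) (at (\<phi> p) within model M)"
    "((f \<circ> inv_into X \<phi>) has_derivative (L \<circ> D)) (at (\<phi> p) within model M)"
    using assms by (fastforce simp: has_differential_def)
  from has_derivative_add_const[OF D(2), of c] D(1)
  show "\<exists>D. (inv_into X \<phi> has_derivative D) (at (\<phi> p) within model M) \<and>
      (((\<lambda>x. f x + c) \<circ> inv_into X \<phi>) has_derivative (L \<circ> D)) (at (\<phi> p) within model M)"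
    by (auto simp: comp_def)
qed

section \<open>Primitives of the Liouville form\<close>

lemma bounded_linear_liouville: "bounded_linear (liouville p)"
  by (auto simp: liouville_def case_prod_unfold intro!: bounded_linear_intros)

text \<open>The formula for \<open>A\<close> is recorded for the closedness argument: if
  \<open>D2 x\<close> is symmetric, then \<open>A x v w - A x w v\<close> is minus
  \<open>Omega\<close> at the vectors \<open>D1 x v\<close> and \<open>D1 x w\<close>.\<close>

lemma liouville_pullback_C1:
  fixes g :: "'m::euclidean_space \<Rightarrow> 'a::euclidean_space \<times> 'a"
  assumes X: "X \<subseteq> S"
    and D1: "\<And>x. x \<in> X \<Longrightarrow> (g has_derivative blinfun_apply (D1 x)) (at x within S)"
    and D2: "\<And>x. x \<in> X \<Longrightarrow> (D1 has_derivative blinfun_apply (D2 x)) (at x within S)"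
    and cont: "continuous_on X D2"
  obtains \<alpha> :: "'m \<Rightarrow> 'm \<Rightarrow>\<^sub>L real" and A
  where "\<And>x v. \<alpha> x v = liouville (g x) (D1 x v)"
    and "\<And>x. x \<in> X \<Longrightarrow> (\<alpha> has_derivative blinfun_apply (A x)) (at x within S)"
    and "continuous_on X A"
    and "\<And>x v w. A x v w = fst (D2 x v w) \<bullet> snd (g x) + fst (D1 x w) \<bullet> snd (D1 x v)"
proof
  interpret comp: bounded_bilinear "(o\<^sub>L) :: (('a \<times> 'a) \<Rightarrow>\<^sub>L real) \<Rightarrow> ('m \<Rightarrow>\<^sub>L ('a \<times> 'a)) \<Rightarrow> ('m \<Rightarrow>\<^sub>L real)"
    by (rule bounded_bilinear_blinfun_compose)
  \<comment> \<open>\<open>?l p\<close> is the Liouville form at \<open>p\<close> as a bounded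
    linear map. It depends linearly on \<open>p\<close>, so it is its own derivative.\<close>
  let ?l = "\<lambda>p::'a \<times> 'a. blinfun_inner_left (snd p) o\<^sub>L fst_blinfun"
  have l: "bounded_linear ?l"
    by (intro bounded_linear_intros)
  let ?\<alpha> = "\<lambda>x. ?l (g x) o\<^sub>L D1 x"
  \<comment> \<open>Product rule: the first summand differentiates \<open>D1\<close>, the second
    differentiates \<open>g\<close> inside the coefficient of the form.\<close>
  let ?A = "\<lambda>x. (comp.prod_right (?l (g x)) o\<^sub>L D2 x) + (comp.prod_left (D1 x) o\<^sub>L (Blinfun ?l o\<^sub>L D1 x))"
  note l_apply = bounded_linear_Blinfun_apply[OF l]
  show "?\<alpha> x v = liouville (g x) (D1 x v)" for x v
    by (simp add: liouville_def case_prod_unfold)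
  show "?A x v w = fst (D2 x v w) \<bullet> snd (g x) + fst (D1 x w) \<bullet> snd (D1 x v)" for x v w
    by (simp add: blinfun.bilinear_simps l_apply)
  show "(?\<alpha> has_derivative blinfun_apply (?A x)) (at x within S)" if "x \<in> X" for x
    using D1[OF that] D2[OF that]
    by (auto intro!: derivative_eq_intros bounded_linear.has_derivative[OF l]
        simp: blinfun.bilinear_simps l_apply fun_eq_iff)
  have "continuous_on X g" "continuous_on X D1"
    using D1 D2 X by (meson continuous_on_eq_continuous_within continuous_within_subset has_derivative_continuous)+
  then show "continuous_on X ?A"
    using cont by (auto intro!: continuous_intros bounded_linear.continuous_on[OF comp.bounded_linear_prod_left]
      bounded_linear.continuous_on[OF comp.bounded_linear_prod_right])
qed

text \<open>In a chart the derivative of \<open>F\<close> is the pullback of the Liouville form by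
  an inverse chart of class C2. This pullback is C1, so \<open>F\<close> is C2.\<close>

lemma smooth_map_on_liouville_primitive:
  assumes M: "immersed_submanifold \<Gamma>" and F: "\<And>w. w \<in> W \<Longrightarrow> has_differential \<Gamma> F w (liouville w)"
  shows "smooth_map_on \<Gamma> W F"
  unfolding smooth_map_on_def
proof (clarify)
  fix X \<phi>
  assume X: "(X, \<phi>) \<in> atlas \<Gamma>"
  note chart = is_chart_inv_into[OF immersed_submanifoldD(1)[OF M X]]
  let ?i = "inv_into X \<phi>" and ?Z = "\<phi> ` (X \<inter> W)"
  have i: "continuous_map (top_of_set (\<phi> ` X)) (mtop \<Gamma>) ?i"
    using chart(2) by (simp add: continuous_map_in_subtopology)
  obtain D1 D2 where D1: "\<And>x. x \<in> \<phi> ` X \<Longrightarrow> (?i has_derivative blinfun_apply (D1 x)) (at x within model \<Gamma>)"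
    and D2: "\<And>x. x \<in> \<phi> ` X \<Longrightarrow> (D1 has_derivative blinfun_apply (D2 x)) (at x within model \<Gamma>)"
    and cont: "continuous_on (\<phi> ` X) D2"
    using C2_onE[OF immersed_submanifoldD(4)[OF M X]] by metis
  have Z: "?Z \<subseteq> \<phi> ` X" "?Z \<subseteq> model \<Gamma>"
    using chart(7) by auto
  obtain \<alpha> A where \<alpha>: "\<And>x v. blinfun_apply (\<alpha> x) v = liouville (?i x) (D1 x v)"
    and A: "\<And>x. x \<in> ?Z \<Longrightarrow> (\<alpha> has_derivative blinfun_apply (A x)) (at x within model \<Gamma>)"
    and contA: "continuous_on ?Z A"
    by (rule liouville_pullback_C1[OF Z(2), of ?i D1 D2])
      (use D1 D2 Z(1) cont continuous_on_subset in blast)+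
  show "C2_on (model \<Gamma>) (F \<circ> ?i) ?Z"
    unfolding C2_on_def
  proof (intro exI[of _ \<alpha>] exI[of _ A] conjI ballI)
    fix x
    assume x: "x \<in> ?Z"
    then have at: "at x within \<phi> ` X = at x within model \<Gamma>"
      using Z by (intro at_within_openin[OF chart(6)]) auto
    have w: "?i x \<in> W"
      using x chart(1) by auto
    have "((F \<circ> ?i) has_derivative (liouville (?i x) \<circ> blinfun_apply (D1 x))) (at x within \<phi> ` X)"
      using D1[of x] x Z
      by (intro has_differential_chain[OF M bounded_linear_liouville F[OF w] i]) (auto simp: at)
    then show "((F \<circ> ?i) has_derivative blinfun_apply (\<alpha> x)) (at x within model \<Gamma>)"
      by (simp add: at comp_def \<alpha>[abs_def])
  qed (fact A contA)+
qed

text \<open>The form is pulled back to a ball in the chart's ambient vector space, where isotropy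
  makes it closed; the primitive found there is carried back by the chart.\<close>

lemma liouville_primitive_exists:
  assumes M: "immersed_submanifold \<Gamma>" and iso: "isotropic \<Gamma>" and \<gamma>: "\<gamma> \<in> points \<Gamma>"
  obtains W F where "openin (mtop \<Gamma>) W" "\<gamma> \<in> W" "\<And>w. w \<in> W \<Longrightarrow> has_differential \<Gamma> F w (liouville w)"
proof -
  obtain X \<phi> where X: "(X, \<phi>) \<in> atlas \<Gamma>" "\<gamma> \<in> X"
    using M \<gamma> unfolding immersed_submanifold_def smooth_manifold_def by blast
  note chart = is_chart_inv_into[OF immersed_submanifoldD(1)[OF M X(1)]]
  let ?i = "inv_into X \<phi>"
  obtain P where P: "\<And>x. blinfun_apply P x \<in> model \<Gamma>" "\<And>x. x \<in> model \<Gamma> \<Longrightarrow> P x = x"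
    using linear_retraction_exists[OF immersed_submanifoldD(2)[OF M X(1)]] by metis
  let ?g = "\<lambda>x. ?i (P x)" and ?U = "blinfun_apply P -` \<phi> ` X"
  obtain D1 D2 where D1: "\<And>x. x \<in> ?U \<Longrightarrow> (?g has_derivative blinfun_apply (D1 x)) (at x)"
    and D2: "\<And>x. x \<in> ?U \<Longrightarrow> (D1 has_derivative blinfun_apply (D2 x)) (at x)"
    and cont: "continuous_on ?U D2"
    using C2_onE[OF C2_on_compose_retraction[OF P(1) immersed_submanifoldD(4)[OF M X(1)]]] by metis
  have U: "open ?U"
    by (rule open_vimage_retraction[OF P(1) chart(6)])
  have \<phi>\<gamma>: "\<phi> \<gamma> \<in> ?U"
    using P(2)[of "\<phi> \<gamma>"] X(2) chart(7) by auto
  then obtain r where r: "r > 0" "ball (\<phi> \<gamma>) r \<subseteq> ?U"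
    using U by (meson openE)
  let ?B = "ball (\<phi> \<gamma>) r"
  obtain \<alpha> A where \<alpha>: "\<And>x v. blinfun_apply (\<alpha> x) v = liouville (?g x) (D1 x v)"
    and A: "\<And>x. x \<in> ?U \<Longrightarrow> (\<alpha> has_derivative blinfun_apply (A x)) (at x)"
    and contA: "continuous_on ?U A"
    and A_apply: "\<And>x v w. A x v w = fst (D2 x v w) \<bullet> snd (?g x) + fst (D1 x w) \<bullet> snd (D1 x v)"
    using liouville_pullback_C1[OF subset_UNIV D1 D2 cont] by metis
  have tangent: "D1 x v \<in> tangent_space \<Gamma> (?g x)" if x: "x \<in> ?U" for x v
  proof -
    have px: "P x \<in> \<phi> ` X" "?g x \<in> X" "\<phi> (?g x) = P x"
      using x by (auto intro: inv_into_into f_inv_into_f)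
    then obtain D where D: "(?i has_derivative D) (at (\<phi> (?g x)) within model \<Gamma>)"
      using M X(1) by (fastforce simp: immersed_submanifold_def)
    \<comment> \<open>The derivative passes through \<open>P\<close>, so its values are images of
      model vectors and hence tangent, even when \<open>x\<close> lies off the model space.\<close>
    have "blinfun_apply (D1 x) = (\<lambda>v. D (P v))"
      using has_derivative_unique[OF D1[OF x] has_derivative_compose_retraction[OF P(1)]] D px(3) by simp
    then show ?thesis
      using immersed_submanifold_derivative(2)[OF M X(1) px(2) D P(1)] by simp
  qed
  have sym: "A x v w = A x w v" if x: "x \<in> ?U" for x v w
  proof -
    have "?g x \<in> points \<Gamma>"
      using x by (intro subsetD[OF immersed_submanifoldD(3)[OF M X(1)]] inv_into_into) simp
    then have "Omega (?g x) (D1 x v) (D1 x w) = 0"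
      using iso tangent[OF x] by (simp add: isotropic_def)
    moreover have "D2 x v w = D2 x w v"
      by (rule second_derivative_symmetric[OF U x D1 D2 cont])
    ultimately show ?thesis
      by (simp add: A_apply Omega_eq inner_commute)
  qed
  have "\<exists>F. \<forall>x\<in>?B. (F has_derivative blinfun_apply (\<alpha> x)) (at x)"
    by (rule closed_one_form_exact[of _ \<alpha> A])
      (use r(2) A sym continuous_on_subset[OF contA r(2)] in auto)
  then obtain F where F: "\<And>x. x \<in> ?B \<Longrightarrow> (F has_derivative blinfun_apply (\<alpha> x)) (at x)"
    by blast
  define W where "W = {w \<in> X. \<phi> w \<in> ?B}"
  have W: "openin (mtop \<Gamma>) W"
    unfolding W_def by (rule is_chart_openin_vimage[OF immersed_submanifoldD(1)[OF M X(1)] open_ball])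
  have "has_differential \<Gamma> (F \<circ> \<phi>) w (liouville w)" if w: "w \<in> W" for w
  proof (rule has_differential_from_chart[OF M X(1) _ bounded_linear_liouville])
    have wX: "w \<in> X" "\<phi> w \<in> \<phi> ` X" and wB: "\<phi> w \<in> ?B"
      using w by (auto simp: W_def)
    then show "w \<in> X"
      by simp
    have S: "\<phi> w \<in> model \<Gamma>"
      using chart(7) wX by auto
    have g: "?g (\<phi> w) = w"
      using P(2)[OF S] chart(1) wX by simp
    have at: "at (\<phi> w) within \<phi> ` X = at (\<phi> w) within model \<Gamma>"
      by (rule at_within_openin[OF chart(6) wX(2)])
    \<comment> \<open>On the model space \<open>P\<close> is the identity, so \<open>?g\<close> and
      \<open>?i\<close> agree there and share the derivative within it.\<close>
    show "(?i has_derivative blinfun_apply (D1 (\<phi> w))) (at (\<phi> w) within model \<Gamma>)"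
      by (rule has_derivative_transform[OF S _ has_derivative_at_withinI[OF D1]])
        (use P(2) wB r(2) in auto)
    have "((F \<circ> \<phi> \<circ> ?i) has_derivative blinfun_apply (\<alpha> (\<phi> w))) (at (\<phi> w) within \<phi> ` X)"
      by (rule has_derivative_transform[OF wX(2) _ has_derivative_at_withinI[OF F[OF wB]]])
        (simp add: f_inv_into_f)
    then show "((F \<circ> \<phi> \<circ> ?i) has_derivative (liouville w \<circ> blinfun_apply (D1 (\<phi> w)))) (at (\<phi> w) within model \<Gamma>)"
      by (simp add: at comp_def \<alpha>[abs_def] g)
  qed
  moreover have "\<gamma> \<in> W"
    using X(2) r(1) by (simp add: W_def)
  ultimately show ?thesis
    using W that by blast
qed

section \<open>Comparison of a primitive with the support function\<close>

lemma liouville_primitive_eq_support_function: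
  fixes \<Gamma> :: "('a::euclidean_space \<times> 'a, 'k::euclidean_space) manifold"
    and M :: "('a, 'm::euclidean_space) manifold"
  assumes \<Gamma>: "immersed_submanifold \<Gamma>" and M: "immersed_submanifold M"
    and \<nu>: "unit_normal_section M \<nu>" "continuous_map (mtop M) (mtop \<Gamma>) (Phi \<nu>)"
    and p: "p \<in> points M"
    and W: "openin (mtop \<Gamma>) W" "Phi \<nu> p \<in> W"
    and F: "\<And>w. w \<in> W \<Longrightarrow> has_differential \<Gamma> F w (liouville w)"
  obtains V c where "openin (mtop M) V" "p \<in> V" "Phi \<nu> ` V \<subseteq> W"
    "\<And>q. q \<in> V \<Longrightarrow> F (Phi \<nu> q) + c = \<nu> q \<bullet> q"
proof -
  obtain Y \<psi> where Y: "(Y, \<psi>) \<in> atlas M" "p \<in> Y"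
    using M p unfolding immersed_submanifold_def smooth_manifold_def by blast
  note chart = is_chart_inv_into[OF immersed_submanifoldD(1)[OF M Y(1)]]
  let ?j = "inv_into Y \<psi>"
  have Ypts: "Y \<subseteq> points M"
    by (rule immersed_submanifoldD(3)[OF M Y(1)])
  obtain P where P: "\<And>x. blinfun_apply P x \<in> model M" "\<And>x. x \<in> model M \<Longrightarrow> P x = x"
    using linear_retraction_exists[OF immersed_submanifoldD(2)[OF M Y(1)]] by metis
  define q where "q = (\<lambda>x. ?j (P x))"
  define n where "n = (\<lambda>x. \<nu> (q x))"
  let ?U = "blinfun_apply P -` \<psi> ` Y"
  have "continuous_map (top_of_set ?U) (top_of_set (\<psi> ` Y)) P"
    by (simp add: linear_continuous_on[OF blinfun.bounded_linear_right] image_subset_iff)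
  from continuous_map_compose[OF this chart(2)]
  have q: "continuous_map (top_of_set ?U) (mtop M) q"
    by (simp add: continuous_map_in_subtopology q_def comp_def)
  from continuous_map_compose[OF this \<nu>(2)]
  have u: "continuous_map (top_of_set ?U) (mtop \<Gamma>) (\<lambda>x. Phi \<nu> (q x))"
    by (simp add: comp_def)
  have "open ?U"
    by (rule open_vimage_retraction[OF P(1) chart(6)])
  \<comment> \<open>Openness of this preimage rests on the continuity of \<open>Phi \<nu>\<close>
    into the topology of \<open>\<Gamma>\<close> itself, in which \<open>W\<close> is open.\<close>
  moreover have "openin (top_of_set ?U) {x \<in> ?U. Phi \<nu> (q x) \<in> W}"
    using openin_continuous_map_preimage[OF u W(1)] by simp
  ultimately have "open {x \<in> ?U. Phi \<nu> (q x) \<in> W}"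
    using openin_open_eq by blast
  moreover have q\<psi>: "P (\<psi> z) = \<psi> z" "q (\<psi> z) = z" if "z \<in> Y" for z
    using P(2)[of "\<psi> z"] chart(1,7) that by (auto simp: q_def)
  then have "\<psi> p \<in> {x \<in> ?U. Phi \<nu> (q x) \<in> W}"
    using Y(2) W(2) by auto
  ultimately obtain r where r: "r > 0" "ball (\<psi> p) r \<subseteq> {x \<in> ?U. Phi \<nu> (q x) \<in> W}"
    by (meson openE)
  let ?B = "ball (\<psi> p) r"
  have qY: "q x \<in> Y" "q x \<in> points M" "P x \<in> \<psi> ` Y" "\<psi> (q x) = P x" "Phi \<nu> (q x) \<in> W" if "x \<in> ?B" for x
    using r(2) that Ypts by (auto simp: q_def subset_iff intro: inv_into_into f_inv_into_f)
  have uB: "continuous_map (top_of_set ?B) (mtop \<Gamma>) (\<lambda>x. Phi \<nu> (q x))"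
    using continuous_map_from_subtopology_mono[OF u] r(2) by (auto simp: subset_iff)
  have unit: "n x \<bullet> n x = 1" if "x \<in> ?B" for x
    using \<nu>(1) qY(2)[OF that] by (simp add: unit_normal_section_def n_def dot_square_norm)
  have "((\<lambda>x. F (Phi \<nu> (q x)) - n x \<bullet> q x) has_derivative (\<lambda>_. 0)) (at x within ?B)" if x: "x \<in> ?B" for x
  proof -
    have at: "at x within ?B = at x"
      using x by (rule at_within_open) simp
    obtain D where D: "(?j has_derivative D) (at (P x) within model M)"
      using M Y(1) qY(1,4)[OF x] by (fastforce simp: immersed_submanifold_def)
    have dq: "(q has_derivative (\<lambda>v. D (P v))) (at x)"
      unfolding q_def by (rule has_derivative_compose_retraction[OF P(1) D])
    have "C2_on (model M) (\<nu> \<circ> ?j) (\<psi> ` (Y \<inter> points M))"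
      using \<nu>(1) Y(1) by (auto simp: unit_normal_section_def smooth_map_on_def)
    moreover have "P x \<in> \<psi> ` (Y \<inter> points M)"
      using qY(3)[OF x] Ypts by auto
    ultimately obtain N where "((\<nu> \<circ> ?j) has_derivative N) (at (P x) within model M)"
      unfolding C2_on_def by blast
    from has_derivative_compose_retraction[OF P(1) this]
    have dn: "(n has_derivative (\<lambda>v. N (P v))) (at x)"
      by (simp add: n_def q_def)
    have normal: "n x \<bullet> D (P v) = 0" for v
    proof -
      have "D (P v) \<in> tangent_space M (q x)"
        using immersed_submanifold_derivative(2)[OF M Y(1) qY(1)[OF x] _ P(1)] D qY(4)[OF x] by simp
      then show ?thesis
        using \<nu>(1) qY(2)[OF x] by (simp add: unit_normal_section_def n_def)
    qed
    \<comment> \<open>Differentiating the constant \<open>n x \<bullet> n x = 1\<close> shows that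
      the derivative of the normal is orthogonal to the normal.\<close>
    have "((\<lambda>x. n x \<bullet> n x) has_derivative (\<lambda>v. n x \<bullet> N (P v) + N (P v) \<bullet> n x)) (at x within ?B)"
      unfolding at by (rule has_derivative_inner[OF dn dn])
    moreover have "((\<lambda>x. n x \<bullet> n x) has_derivative (\<lambda>_. 0)) (at x within ?B)"
      by (rule has_derivative_transform[OF x unit has_derivative_const])
    ultimately have "(\<lambda>v. n x \<bullet> N (P v) + N (P v) \<bullet> n x) = (\<lambda>_. 0)"
      unfolding at by (rule has_derivative_unique)
    then have orth: "N (P v) \<bullet> n x = 0" for v
      by (simp add: fun_eq_iff inner_commute)
    have dnq: "((\<lambda>x. n x \<bullet> q x) has_derivative (\<lambda>v. n x \<bullet> D (P v) + N (P v) \<bullet> q x)) (at x)"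
      by (rule has_derivative_inner[OF dn dq])
    \<comment> \<open>The product rule applied to \<open>Phi \<nu> (q x)\<close>. The Liouville form
      sees only the first component of \<open>?E v\<close>, and \<open>orth\<close> removes the
      normal part of the base point.\<close>
    let ?E = "\<lambda>v. (N (P v), D (P v) - ((n x \<bullet> q x) *\<^sub>R N (P v) + (n x \<bullet> D (P v) + N (P v) \<bullet> q x) *\<^sub>R n x))"
    have "(\<lambda>x. Phi \<nu> (q x)) = (\<lambda>x. (n x, q x - (n x \<bullet> q x) *\<^sub>R n x))"
      by (simp add: Phi_def n_def)
    with has_derivative_Pair[OF dn has_derivative_diff[OF dq has_derivative_scaleR[OF dnq dn]]]
    have "((\<lambda>x. Phi \<nu> (q x)) has_derivative ?E) (at x within ?B)"
      by (simp only: at)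
    from has_differential_chain[OF \<Gamma> bounded_linear_liouville F[OF qY(5)[OF x]] uB this x]
    have "((\<lambda>x. F (Phi \<nu> (q x))) has_derivative (\<lambda>v. liouville (Phi \<nu> (q x)) (?E v))) (at x)"
      by (simp only: at comp_def)
    moreover have "liouville (Phi \<nu> (q x)) (?E v) = N (P v) \<bullet> q x" for v
      using orth[of v] by (simp add: liouville_def Phi_def n_def inner_diff_right)
    ultimately have "((\<lambda>x. F (Phi \<nu> (q x))) has_derivative (\<lambda>v. N (P v) \<bullet> q x)) (at x)"
      by (simp only:)
    \<comment> \<open>The terms \<open>N (P v) \<bullet> q x\<close> cancel and the remaining
      \<open>n x \<bullet> D (P v)\<close> is zero by \<open>normal\<close>.\<close>
    from has_derivative_diff[OF this dnq] show ?thesis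
      by (simp add: at normal)
  qed
  from has_derivative_zero_constant[OF convex_ball this]
  obtain c where c: "\<And>x. x \<in> ?B \<Longrightarrow> F (Phi \<nu> (q x)) - n x \<bullet> q x = c"
    by blast
  define V where "V = {z \<in> Y. \<psi> z \<in> ?B}"
  have "openin (mtop M) V"
    unfolding V_def by (rule is_chart_openin_vimage[OF immersed_submanifoldD(1)[OF M Y(1)] open_ball])
  moreover have "p \<in> V"
    using Y(2) r(1) by (simp add: V_def)
  moreover have "Phi \<nu> ` V \<subseteq> W"
    using qY(5) q\<psi>(2) by (force simp: V_def)
  moreover have "F (Phi \<nu> z) + (- c) = \<nu> z \<bullet> z" if "z \<in> V" for z
    using c[of "\<psi> z"] q\<psi>(2)[of z] that by (simp add: V_def n_def)
  ultimately show ?thesis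
    by (rule that)
qed

text \<open>The multiple of \<open>\<nu> q\<close> that \<open>Phi\<close> subtracts is the one that
  \<open>Psi\<close> restores at this parameter.\<close>

lemma Psi_Phi: "Psi (Phi \<nu> q, \<nu> q \<bullet> q) = q"
  by (simp add: Psi_def Phi_def)

theorem theorem1:
  fixes \<Gamma> :: "('a::euclidean_space \<times> 'a, 'k::euclidean_space) manifold"
    and \<U> :: "('a, 'm::euclidean_space) manifold"
  assumes "immersed_submanifold \<Gamma>" and "points \<Gamma> \<subseteq> TSphere" and "isotropic \<Gamma>"
    and "orthogonal_submanifold \<U> \<Gamma>"
    and "points \<U> \<inter> focal_points \<Gamma> = {}"
  shows "\<forall>p\<in>points \<U>. \<exists>V W. \<exists>F :: 'a \<times> 'a \<Rightarrow> real.
    openin (mtop \<U>) V \<and> p \<in> V \<and>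
    openin (mtop \<Gamma>) W \<and> smooth_map_on \<Gamma> W F \<and>
    (\<forall>w\<in>W. has_differential \<Gamma> F w (liouville w)) \<and>
    V \<subseteq> Psi ` {(w, F w) |w. w \<in> W}"
proof
  fix p
  assume p: "p \<in> points \<U>"
  obtain \<nu> where U: "immersed_submanifold \<U>" and \<nu>: "unit_normal_section \<U> \<nu>"
    and Phi: "Phi \<nu> ` points \<U> \<subseteq> points \<Gamma>" "continuous_map (mtop \<U>) (mtop \<Gamma>) (Phi \<nu>)"
    using assms(4) by (auto simp: orthogonal_submanifold_def)
  have "Phi \<nu> p \<in> points \<Gamma>"
    using Phi(1) p by blast
  then obtain W F where W: "openin (mtop \<Gamma>) W" "Phi \<nu> p \<in> W"
    and F: "\<And>w. w \<in> W \<Longrightarrow> has_differential \<Gamma> F w (liouville w)"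
    using liouville_primitive_exists[OF assms(1,3)] by metis
  obtain V c where V: "openin (mtop \<U>) V" "p \<in> V" "Phi \<nu> ` V \<subseteq> W"
    and c: "\<And>q. q \<in> V \<Longrightarrow> F (Phi \<nu> q) + c = \<nu> q \<bullet> q"
    using liouville_primitive_eq_support_function[OF assms(1) U \<nu> Phi(2) p W F] by metis
  \<comment> \<open>The shift keeps the differential and makes the primitive equal to the support
    function along \<open>Phi \<nu>\<close>, the parameter at which \<open>Psi\<close> returns
    \<open>q\<close>.\<close>
  let ?F = "\<lambda>w. F w + c"
  have dF: "has_differential \<Gamma> ?F w (liouville w)" if "w \<in> W" for w
    by (rule has_differential_add_const[OF F[OF that]])
  have "V \<subseteq> Psi ` {(w, ?F w) |w. w \<in> W}"
  proof
    fix q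
    assume q: "q \<in> V"
    then have "q = Psi (Phi \<nu> q, ?F (Phi \<nu> q))"
      by (simp add: c Psi_Phi)
    then show "q \<in> Psi ` {(w, ?F w) |w. w \<in> W}"
      using V(3) q by blast
  qed
  then show "\<exists>V W. \<exists>F :: 'a \<times> 'a \<Rightarrow> real.
    openin (mtop \<U>) V \<and> p \<in> V \<and>
    openin (mtop \<Gamma>) W \<and> smooth_map_on \<Gamma> W F \<and>
    (\<forall>w\<in>W. has_differential \<Gamma> F w (liouville w)) \<and>
    V \<subseteq> Psi ` {(w, F w) |w. w \<in> W}"
    using V(1,2) W(1) smooth_map_on_liouville_primitive[OF assms(1) dF] dF by blast
qed

end
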